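(* For each $n \in \{1, 3, 7\}$ there exists a nonempty open subset $E \subset \mathbb{R}^{2n+1}$ which admits a unit $n$-sphere fibration.
   Context: A unit $n$-sphere in $\mathbb{R}^d$ is a round $n$-dimensional sphere of radius $1$, i.e. a set of the form $\{x \in P : |x-c| = 1\}$ where $P \subset \mathbb{R}^d$ is an affine $(n+1)$-plane and $c \in P$ (its center). A unit $n$-sphere fibration of an open set $E \subset \mathbb{R}^d$ is a decomposition of $E$ as a union of pairwise disjoint unit $n$-spheres contained in $E$ (the fibers) that is continuous, meaning that the map taking $p \in E$ to the fiber containing it is continuous. Explicitly, if $S$ is the fiber through $p$ and $P$ is the affine $(n+1)$-plane containing $S$, then the center $c(p) \in \mathbb{R}^d$ of $S$ and the normal space $\nu(p)$ (the linear $(d-n-1)$-plane orthogonal to $P$, as a point of the Grassmannian) depend continuously on $p$. *)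

theory Defs
  imports "HOL-Analysis.Analysis"
begin

text \<open>
  The Grassmannian of linear \<open>k\<close>-planes carries the quotient topology of the space of \<open>k\<close>-frames
  (linearly independent \<open>k\<close>-tuples of vectors, indexed by \<open>{..<k}\<close>, as a subspace of the \<open>k\<close>-fold
  product) under the map sending a frame to its span.
\<close>

definition frame_space :: "nat \<Rightarrow> (nat \<Rightarrow> 'a::euclidean_space) topology" where
  "frame_space k =
     subtopology (product_topology (\<lambda>_. euclidean) {..<k})
       {f. inj_on f {..<k} \<and> independent (f ` {..<k})}"

definition frame_span :: "nat \<Rightarrow> (nat \<Rightarrow> 'a::euclidean_space) \<Rightarrow> 'a set" where
  "frame_span k f = span (f ` {..<k})"

definition grassmannian :: "nat \<Rightarrow> 'a::euclidean_space set topology" where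
  "grassmannian k =
     topology (\<lambda>U. U \<subseteq> {V. subspace V \<and> dim V = k} \<and>
       openin (frame_space k) {f \<in> topspace (frame_space k). frame_span k f \<in> U})"

lemma openin_grassmannian:
  "openin (grassmannian k) U \<longleftrightarrow>
     U \<subseteq> {V. subspace V \<and> dim V = k} \<and>
     openin (frame_space k) {f \<in> topspace (frame_space k). frame_span k f \<in> U}"
proof -
  let ?X = "frame_space k :: (nat \<Rightarrow> 'a) topology"
  have Int: "{f \<in> topspace ?X. frame_span k f \<in> S \<inter> T} =
      {f \<in> topspace ?X. frame_span k f \<in> S} \<inter> {f \<in> topspace ?X. frame_span k f \<in> T}" for S T
    by blast
  have Un: "{f \<in> topspace ?X. frame_span k f \<in> \<Union>K} =
      (\<Union>S\<in>K. {f \<in> topspace ?X. frame_span k f \<in> S})" for K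
    by blast
  have "istopology (\<lambda>U. U \<subseteq> {V. subspace V \<and> dim V = k} \<and>
      openin ?X {f \<in> topspace ?X. frame_span k f \<in> U})"
    unfolding istopology_def Int Un by (auto intro!: openin_Union)
  then show ?thesis
    by (simp add: grassmannian_def topology_inverse')
qed

lemma frame_span_in:
  assumes "f \<in> topspace (frame_space k)"
  shows "subspace (frame_span k f)" "dim (frame_span k f) = k"
proof -
  have "inj_on f {..<k}" "independent (f ` {..<k})"
    using assms by (auto simp: frame_space_def)
  then show "subspace (frame_span k f)" "dim (frame_span k f) = k"
    by (auto simp: frame_span_def dim_eq_card_independent card_image)
qed

lemma topspace_grassmannian:
  "topspace (grassmannian k) = {V :: 'a::euclidean_space set. subspace V \<and> dim V = k}" (is "_ = ?G")
proof
  show "topspace (grassmannian k) \<subseteq> ?G"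
    using openin_grassmannian openin_topspace by blast
  have "{f \<in> topspace (frame_space k). frame_span k f \<in> ?G} = topspace (frame_space k)"
    using frame_span_in by blast
  then have "openin (grassmannian k) ?G"
    by (simp only: openin_grassmannian openin_topspace subset_refl simp_thms)
  then show "?G \<subseteq> topspace (grassmannian k)"
    by (rule openin_subset)
qed

definition normal_space :: "'a::euclidean_space set \<Rightarrow> 'a set" where
  "normal_space P = {v. \<forall>x\<in>P. \<forall>y\<in>P. v \<bullet> (x - y) = 0}"

definition is_unit_sphere_in ::
  "nat \<Rightarrow> 'a::euclidean_space set \<Rightarrow> 'a \<Rightarrow> 'a set \<Rightarrow> bool" where
  "is_unit_sphere_in n P c S \<longleftrightarrow>
     affine P \<and> aff_dim P = int n + 1 \<and> c \<in> P \<and> S = {x \<in> P. norm (x - c) = 1}"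

definition is_unit_sphere :: "nat \<Rightarrow> 'a::euclidean_space set \<Rightarrow> bool" where
  "is_unit_sphere n S \<longleftrightarrow> (\<exists>P c. is_unit_sphere_in n P c S)"

text \<open>
  The plane and the center are determined by the sphere, so the functions \<open>P\<close> and \<open>c\<close> below are
  uniquely determined on \<open>E\<close> by the decomposition \<open>F\<close>.
\<close>

definition unit_sphere_fibration ::
  "nat \<Rightarrow> 'a::euclidean_space set \<Rightarrow> 'a set set \<Rightarrow> bool" where
  "unit_sphere_fibration n E F \<longleftrightarrow>
     (\<forall>S\<in>F. is_unit_sphere n S) \<and> \<Union>F = E \<and> pairwise disjnt F \<and>
     (\<exists>P c. (\<forall>S\<in>F. \<forall>p\<in>S. is_unit_sphere_in n (P p) (c p) S) \<and>
        continuous_on E c \<and>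
        continuous_map (top_of_set E) (grassmannian (DIM('a) - n - 1)) (\<lambda>p. normal_space (P p)))"

end

theory Submission
  imports Defs
begin

text \<open>
  Let \<open>K\<close> be one of the normed division algebras of real dimension \<open>n + 1 \<in> {2, 4, 8}\<close>, and view the
  ambient space as \<open>K \<oplus> Im K\<close>, with points written as \<open>p = x + y\<close>.  The fibration generalizes the
  Villarceau circles: a torus of revolution of major radius \<open>1\<close> and minor radius \<open>r < 1\<close> is
  foliated by Villarceau circles, whose radius is \<open>1\<close> for every \<open>r\<close>, and letting \<open>r\<close>
  vary fills a solid torus.  In the present language, a point \<open>c \<in> K\<close> with \<open>|c| < 1\<close> is the center
  of one sphere, lying in the linear plane \<open>P\<^sub>c = {x + y. s y = Im (c x\<^sup>*)}\<close> with \<open>s\<^sup>2 = 1 - |c|\<^sup>2\<close>.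

  Why these spheres partition an open set: multiplicativity of the norm says
  \<open>\<langle>x, c\<rangle>\<^sup>2 + |Im (c x\<^sup>*)|\<^sup>2 = |x|\<^sup>2 |c|\<^sup>2\<close>.  On \<open>P\<^sub>c\<close> this turns the equation \<open>|p - c| = 1\<close> into
  \<open>(\<langle>x, c\<rangle> + s\<^sup>2)\<^sup>2 = |x|\<^sup>2\<close>, that is \<open>\<langle>x, c\<rangle> = |x| - s\<^sup>2\<close>, and then \<open>s\<^sup>2 = 2 |x| - |p|\<^sup>2\<close>.  Hence
  \<open>p\<close> determines \<open>s\<close>, the real part \<open>|x| - s\<^sup>2\<close> and the imaginary part \<open>s y\<close> of \<open>c x\<^sup>*\<close>, and so \<open>c\<close>
  itself, by division.  Conversely this recipe produces a sphere through each \<open>p\<close> with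
  \<open>2 |x| > |p|\<^sup>2\<close>; this is \<open>mem_fiber_iff\<close>.  The set so defined is the open
  solid torus \<open>(|x| - 1)\<^sup>2 + |y|\<^sup>2 < 1\<close>.

  The only property of \<open>K\<close> that enters is that the left multiplications \<open>J\<^sub>0 = id, J\<^sub>1, \<dots>, J\<^sub>n\<close> by the
  standard basis send each \<open>x \<noteq> 0\<close> to an orthogonal basis \<open>J\<^sub>0 x, \<dots>, J\<^sub>n x\<close> of \<open>K\<close> consisting of vectors
  of length \<open>|x|\<close>; note that \<open>\<langle>J\<^sub>i x, c\<rangle>\<close> is the \<open>i\<close>-th coordinate of \<open>c x\<^sup>*\<close>.  The locale below
  isolates it, and its instances come from the octonion multiplication table
  (\<open>octonion_orthogonality\<close>).

  For the continuity of the normal spaces it suffices to exhibit a continuous frame, and the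
  equations of \<open>P\<^sub>c\<close> provide one (\<open>normal_vector_independent\<close>).
\<close>

section \<open>Orthogonal multiplications\<close>

text \<open>
  The ambient space is \<open>K \<oplus> Im K\<close>, where the \<open>v i\<close> are the imaginary units in the second summand.
  The operator \<open>J 0\<close> is the projection onto \<open>K\<close>, and \<open>J i\<close> is this projection followed by
  multiplication by the \<open>i\<close>-th unit of \<open>K\<close>; defining the \<open>J i\<close> on the whole space avoids a separate
  type for \<open>K\<close>.
\<close>

locale orthogonal_multiplication =
  fixes n :: nat and v :: "nat \<Rightarrow> 'a::euclidean_space" and J :: "nat \<Rightarrow> 'a \<Rightarrow> 'a"
  assumes DIM_eq: "DIM('a) = 2 * n + 1"
    and v_orthonormal:
      "\<And>i j. i \<in> {1..n} \<Longrightarrow> j \<in> {1..n} \<Longrightarrow> v i \<bullet> v j = (if i = j then 1 else 0)"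
    and J_linear: "\<And>i. i \<le> n \<Longrightarrow> linear (J i)"
    and J_orthogonal_v: "\<And>i j p. i \<le> n \<Longrightarrow> j \<in> {1..n} \<Longrightarrow> J i p \<bullet> v j = 0"
    and J_orthogonal: "\<And>i j p. i \<le> n \<Longrightarrow> j \<le> n \<Longrightarrow>
        J i p \<bullet> J j p = (if i = j then (norm (J 0 p))\<^sup>2 else 0)"
    and J_0: "\<And>p. J 0 p = p - (\<Sum>i=1..n. (p \<bullet> v i) *\<^sub>R v i)"
begin

definition X :: "'a set" where
  "X = {q. \<forall>i\<in>{1..n}. q \<bullet> v i = 0}"

lemma J_in_X: "i \<le> n \<Longrightarrow> J i p \<in> X"
  by (simp add: X_def J_orthogonal_v)

lemma J_0_X: "q \<in> X \<Longrightarrow> J 0 q = q"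
  by (simp add: X_def J_0)

lemma inner_X: "q \<in> X \<Longrightarrow> p \<bullet> q = J 0 p \<bullet> q"
  by (simp add: X_def J_0 inner_diff_left inner_sum_left inner_commute[of "v _" q])

lemma subspace_X: "subspace X"
  by (auto simp: X_def subspace_def inner_add_left)

lemma norm_J_0: "(norm p)\<^sup>2 = (norm (J 0 p))\<^sup>2 + (\<Sum>i=1..n. (p \<bullet> v i)\<^sup>2)"
proof -
  have "p \<bullet> p = (J 0 p + (\<Sum>i=1..n. (p \<bullet> v i) *\<^sub>R v i)) \<bullet> p"
    by (simp add: J_0)
  also have "\<dots> = J 0 p \<bullet> p + (\<Sum>i=1..n. (p \<bullet> v i)\<^sup>2)"
    by (simp add: inner_add_left inner_sum_left power2_eq_square inner_commute[of "v _" p])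
  also have "J 0 p \<bullet> p = J 0 p \<bullet> J 0 p"
    using inner_X[OF J_in_X[of 0 p], of p] by (simp add: inner_commute)
  finally show ?thesis
    by (simp add: power2_norm_eq_inner)
qed

text \<open>
  Polarization of \<open>J i p \<bullet> p = 0\<close>, which holds because \<open>J i p\<close> is orthogonal to \<open>J 0 p\<close> and lies in
  the summand \<open>X\<close>.
\<close>

lemma J_skew:
  assumes "i \<in> {1..n}"
  shows "J i p \<bullet> q = - (p \<bullet> J i q)"
proof -
  have diag: "J i r \<bullet> r = 0" for r
    using inner_X[OF J_in_X[of i r], of r] J_orthogonal[of 0 i r] assms
    by (simp add: inner_commute)
  have "J i (p + q) \<bullet> (p + q) = 0"
    by (rule diag)
  then show ?thesis
    using diag[of p] diag[of q] linear_add[OF J_linear, of i p q] assms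
    by (simp add: inner_add_left inner_add_right inner_commute)
qed

text \<open>
  Division in \<open>K\<close>: together with the \<open>v j\<close>, the vectors \<open>J i p\<close> are \<open>2 n + 1\<close> nonzero orthogonal
  vectors, so an element of \<open>X\<close> is recovered from its products with them.
\<close>

lemma J_expansion:
  assumes "q \<in> X"
  shows "(norm (J 0 p))\<^sup>2 *\<^sub>R q = (\<Sum>i\<le>n. (J i p \<bullet> q) *\<^sub>R J i p)"
proof (cases "J 0 p = 0")
  case True
  have "J i p = 0" if "i \<le> n" for i
    using J_orthogonal[OF that that, of p] True by simp
  then show ?thesis
    using True by simp
next
  case False
  let ?A = "(\<lambda>i. J i p) ` {..n}" and ?B = "v ` {1..n}"
  have injA: "inj_on (\<lambda>i. J i p) {..n}"
  proof (rule inj_onI)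
    fix i j assume ij: "i \<in> {..n}" "j \<in> {..n}" "J i p = J j p"
    then show "i = j"
      using J_orthogonal[of i j p] J_orthogonal[of i i p] False by (auto split: if_splits)
  qed
  have injB: "inj_on v {1..n}"
  proof (rule inj_onI)
    fix i j assume ij: "i \<in> {1..n}" "j \<in> {1..n}" "v i = v j"
    then show "i = j"
      using v_orthonormal[of i j] v_orthonormal[of i i] by (auto split: if_splits)
  qed
  have orth: "pairwise orthogonal (?A \<union> ?B)"
    unfolding pairwise_def orthogonal_def
    using J_orthogonal v_orthonormal J_orthogonal_v
    by (auto simp: inner_commute[of "v _" "J _ _"])
  have nz: "0 \<notin> ?A \<union> ?B"
  proof
    assume "0 \<in> ?A \<union> ?B"
    then consider i where "i \<le> n" "J i p = 0" | i where "i \<in> {1..n}" "v i = 0"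
      by (metis UnE atMost_iff imageE)
    then show False
    proof cases
      case 1
      then show False
        using J_orthogonal[of i i p] False by simp
    next
      case 2
      then show False
        using v_orthonormal[of i i] by simp
    qed
  qed
  have "?A \<inter> ?B = {}"
  proof (rule ccontr)
    assume "?A \<inter> ?B \<noteq> {}"
    then obtain w where "w \<in> ?A" "w \<in> ?B"
      by blast
    then obtain i j where "i \<le> n" "w = J i p" "j \<in> {1..n}" "w = v j"
      by blast
    then show False
      using J_orthogonal_v[of i j p] v_orthonormal[of j j] by simp
  qed
  then have card: "card (?A \<union> ?B) = DIM('a)"
    by (simp add: card_Un_disjoint card_image[OF injA] card_image[OF injB] DIM_eq del: One_nat_def)
  have "independent (?A \<union> ?B)"
    by (rule pairwise_orthogonal_independent[OF orth nz])
  then have span: "span (?A \<union> ?B) = UNIV"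
    using card by (metis card_eq_dim dim_UNIV finite_imageI finite_Un finite_atMost
        finite_atLeastAtMost subset_UNIV top.extremum_uniqueI)
  define z where "z = (norm (J 0 p))\<^sup>2 *\<^sub>R q - (\<Sum>i\<le>n. (J i p \<bullet> q) *\<^sub>R J i p)"
  have "z \<in> X"
    unfolding z_def using assms J_in_X
    by (intro subspace_diff subspace_sum subspace_scale subspace_X) auto
  then have zB: "orthogonal z b" if "b \<in> ?B" for b
    using that by (auto simp: X_def orthogonal_def)
  have zA: "orthogonal z b" if b: "b \<in> ?A" for b
  proof -
    obtain j where j: "j \<le> n" "b = J j p"
      using b by auto
    have "(\<Sum>i\<le>n. (J i p \<bullet> q) * (J i p \<bullet> J j p)) =
        (\<Sum>i\<le>n. if i = j then (J j p \<bullet> q) * (norm (J 0 p))\<^sup>2 else 0)"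
      by (rule sum.cong) (use j J_orthogonal in auto)
    also have "\<dots> = (J j p \<bullet> q) * (norm (J 0 p))\<^sup>2"
      using j by simp
    finally show ?thesis
      by (simp add: orthogonal_def z_def j inner_diff_left inner_sum_left inner_commute[of q])
  qed
  have "orthogonal z z"
    by (rule orthogonal_to_span[of _ "?A \<union> ?B"]) (use zA zB span in auto)
  then show ?thesis
    by (simp add: orthogonal_self z_def)
qed

text \<open>Multiplicativity of the norm of \<open>K\<close>.\<close>

lemma J_parseval:
  assumes "q \<in> X"
  shows "(norm (J 0 p))\<^sup>2 * (norm q)\<^sup>2 = (J 0 p \<bullet> q)\<^sup>2 + (\<Sum>i=1..n. (J i p \<bullet> q)\<^sup>2)"
proof -
  have "(norm (J 0 p))\<^sup>2 * (norm q)\<^sup>2 = ((norm (J 0 p))\<^sup>2 *\<^sub>R q) \<bullet> q"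
    by (simp add: power2_norm_eq_inner)
  also have "\<dots> = (\<Sum>i\<le>n. (J i p \<bullet> q)\<^sup>2)"
    unfolding J_expansion[OF assms] by (simp add: inner_sum_left power2_eq_square)
  also have "{..n} = insert 0 {1..n}"
    by auto
  finally show ?thesis
    by simp
qed

section \<open>The fibers\<close>

definition tilt :: "'a \<Rightarrow> real" where
  "tilt c = sqrt (1 - (norm c)\<^sup>2)"

definition plane :: "'a \<Rightarrow> 'a set" where
  "plane c = {p. \<forall>i\<in>{1..n}. tilt c * (p \<bullet> v i) = J i p \<bullet> c}"

definition fiber :: "'a \<Rightarrow> 'a set" where
  "fiber c = {p \<in> plane c. norm (p - c) = 1}"

definition height :: "'a \<Rightarrow> real" where
  "height p = 2 * norm (J 0 p) - (norm p)\<^sup>2"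

definition solid_torus :: "'a set" where
  "solid_torus = {p. 0 < height p}"

text \<open>
  The solution \<open>c\<close> of \<open>J 0 p \<bullet> c = |x| - s\<^sup>2\<close>, \<open>J i p \<bullet> c = s (p \<bullet> v i)\<close>, where \<open>x = J 0 p\<close> and
  \<open>s\<^sup>2 = height p\<close>.
\<close>

definition center :: "'a \<Rightarrow> 'a" where
  "center p = (1 / (norm (J 0 p))\<^sup>2) *\<^sub>R
     ((norm (J 0 p) - height p) *\<^sub>R J 0 p + (\<Sum>i=1..n. (sqrt (height p) * (p \<bullet> v i)) *\<^sub>R J i p))"

lemma J_0_nonzero: "p \<in> solid_torus \<Longrightarrow> J 0 p \<noteq> 0"
  by (auto simp: solid_torus_def height_def)

lemma center_in_X: "center p \<in> X"
  unfolding center_def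
  by (intro subspace_scale subspace_add subspace_sum subspace_X J_in_X) auto

lemma inner_J_0_center:
  assumes "p \<in> solid_torus"
  shows "J 0 p \<bullet> center p = norm (J 0 p) - height p"
proof -
  have "(\<Sum>i=1..n. sqrt (height p) * (p \<bullet> v i) * (J 0 p \<bullet> J i p)) = 0"
    by (rule sum.neutral) (simp add: J_orthogonal)
  then show ?thesis
    using J_0_nonzero[OF assms]
    by (simp add: center_def inner_add_right inner_sum_right J_orthogonal)
qed

lemma inner_J_center:
  assumes "p \<in> solid_torus" "j \<in> {1..n}"
  shows "J j p \<bullet> center p = sqrt (height p) * (p \<bullet> v j)"
proof -
  have "(\<Sum>i=1..n. sqrt (height p) * (p \<bullet> v i) * (J j p \<bullet> J i p)) =
      (\<Sum>i=1..n. if i = j then sqrt (height p) * (p \<bullet> v j) * (norm (J 0 p))\<^sup>2 else 0)"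
    by (rule sum.cong) (use assms J_orthogonal in auto)
  also have "\<dots> = sqrt (height p) * (p \<bullet> v j) * (norm (J 0 p))\<^sup>2"
    using assms by simp
  finally have "(\<Sum>i=1..n. sqrt (height p) * (p \<bullet> v i) * (J j p \<bullet> J i p)) =
      sqrt (height p) * (p \<bullet> v j) * (norm (J 0 p))\<^sup>2" .
  then show ?thesis
    using J_0_nonzero[OF assms(1)] assms(2)
    by (simp add: center_def inner_add_right inner_sum_right J_orthogonal)
qed

lemma norm_center:
  assumes "p \<in> solid_torus"
  shows "(norm (center p))\<^sup>2 = 1 - height p"
proof -
  let ?x = "norm (J 0 p)" and ?h = "height p" and ?y = "\<Sum>i=1..n. (p \<bullet> v i)\<^sup>2"
  have h: "?h > 0"
    using assms by (simp add: solid_torus_def)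
  have y: "?y = 2 * ?x - ?h - ?x\<^sup>2"
    using norm_J_0[of p] by (simp add: height_def)
  have "?x\<^sup>2 * (norm (center p))\<^sup>2 = (?x - ?h)\<^sup>2 + ?h * ?y"
    using J_parseval[OF center_in_X, of p p] assms h
    by (simp add: inner_J_0_center inner_J_center power_mult_distrib sum_distrib_left)
  also have "\<dots> = ?x\<^sup>2 * (1 - ?h)"
    unfolding y by (simp add: power2_eq_square algebra_simps)
  finally show ?thesis
    using J_0_nonzero[OF assms] by simp
qed

lemma norm_center_less_1: "p \<in> solid_torus \<Longrightarrow> norm (center p) < 1"
  using norm_center[of p] abs_square_less_1[of "norm (center p)"] by (simp add: solid_torus_def)

lemma tilt_center: "p \<in> solid_torus \<Longrightarrow> tilt (center p) = sqrt (height p)"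
  by (simp add: tilt_def norm_center)

lemma tilt_pos: "norm c < 1 \<Longrightarrow> 0 < tilt c"
  by (simp add: tilt_def abs_square_less_1)

lemma tilt_square: "norm c < 1 \<Longrightarrow> (tilt c)\<^sup>2 = 1 - (norm c)\<^sup>2"
  using abs_square_less_1[of "norm c"] by (simp add: tilt_def)

lemma mem_fiber_center:
  assumes "p \<in> solid_torus"
  shows "p \<in> fiber (center p)"
proof -
  have "(norm (p - center p))\<^sup>2 = (norm p)\<^sup>2 - 2 * (p \<bullet> center p) + (norm (center p))\<^sup>2"
    by (simp add: power2_norm_eq_inner inner_diff_left inner_diff_right inner_commute)
  also have "p \<bullet> center p = norm (J 0 p) - height p"
    using inner_X[OF center_in_X, of p p] inner_J_0_center[OF assms] by simp
  also have "(norm p)\<^sup>2 - 2 * (norm (J 0 p) - height p) + (norm (center p))\<^sup>2 = 1"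
    unfolding norm_center[OF assms] by (simp add: height_def)
  finally have "norm (p - center p) = 1"
    by (metis norm_ge_zero one_power2 power2_eq_iff_nonneg zero_le_one)
  then show ?thesis
    using assms by (simp add: fiber_def plane_def tilt_center inner_J_center)
qed

text \<open>
  The Parseval identity \<open>J_parseval\<close> and the equation of the unit sphere combine to
  \<open>(J 0 p \<bullet> c + s\<^sup>2)\<^sup>2 = |J 0 p|\<^sup>2\<close>.  This determines all products \<open>J i p \<bullet> c\<close> from \<open>p\<close> alone, and
  \<open>J_expansion\<close> then determines \<open>c\<close>.
\<close>

lemma fiber_point:
  assumes c: "c \<in> X" "norm c < 1" and p: "p \<in> fiber c"
  shows "p \<in> solid_torus" "center p = c"
proof -
  let ?x = "norm (J 0 p)" and ?y = "\<Sum>i=1..n. (p \<bullet> v i)\<^sup>2" and ?s = "tilt c"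
  define t where "t = J 0 p \<bullet> c"
  have s: "?s > 0" "?s\<^sup>2 = 1 - (norm c)\<^sup>2"
    using tilt_pos tilt_square c by auto
  have J_c: "J i p \<bullet> c = ?s * (p \<bullet> v i)" if "i \<in> {1..n}" for i
    using p that by (simp add: fiber_def plane_def)
  have parseval: "?x\<^sup>2 * (norm c)\<^sup>2 = t\<^sup>2 + ?s\<^sup>2 * ?y"
    using J_parseval[OF c(1), of p]
    by (simp add: J_c t_def power_mult_distrib sum_distrib_left)
  have "(norm (p - c))\<^sup>2 = (norm p)\<^sup>2 - 2 * (p \<bullet> c) + (norm c)\<^sup>2"
    by (simp add: power2_norm_eq_inner inner_diff_left inner_diff_right inner_commute)
  then have dist: "(norm p)\<^sup>2 - 2 * t + (norm c)\<^sup>2 = 1"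
    using p inner_X[OF c(1), of p] by (simp add: fiber_def t_def)
  have y: "?y = (norm p)\<^sup>2 - ?x\<^sup>2"
    using norm_J_0[of p] by simp
  have norm_c: "(norm c)\<^sup>2 = 1 - ?s\<^sup>2" and norm_p: "(norm p)\<^sup>2 = 2 * t + ?s\<^sup>2"
    using dist s(2) by auto
  have "(t + ?s\<^sup>2 - ?x) * (t + ?s\<^sup>2 + ?x) = 0"
    using parseval unfolding y norm_c norm_p by (simp add: power2_eq_square algebra_simps)
  \<comment> \<open>Only the sign with \<open>t + s\<^sup>2 = |x|\<close> can occur, because \<open>|c| < 1\<close>.\<close>
  moreover have "t + ?s\<^sup>2 + ?x > 0"
  proof -
    have "\<bar>t\<bar> \<le> ?x * norm c"
      unfolding t_def by (rule Cauchy_Schwarz_ineq2)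
    also have "\<dots> \<le> ?x"
      using c(2) by (simp add: mult_left_le)
    finally show ?thesis
      using zero_less_power[OF s(1), of 2] by linarith
  qed
  ultimately have t: "t = ?x - ?s\<^sup>2"
    by simp
  have height: "height p = ?s\<^sup>2"
    unfolding height_def norm_p t by simp
  show E: "p \<in> solid_torus"
    using s(1) by (simp add: solid_torus_def height)
  have "?x\<^sup>2 *\<^sub>R c = (\<Sum>i\<le>n. (J i p \<bullet> c) *\<^sub>R J i p)"
    by (rule J_expansion[OF c(1)])
  also have "{..n} = insert 0 {1..n}"
    by auto
  also have "(\<Sum>i\<in>insert 0 {1..n}. (J i p \<bullet> c) *\<^sub>R J i p) = ?x\<^sup>2 *\<^sub>R center p"
    using J_0_nonzero[OF E] s(1) t
    by (simp add: center_def height J_c t_def)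
  finally show "center p = c"
    using J_0_nonzero[OF E] by simp
qed

lemma mem_fiber_iff:
  assumes "c \<in> X" "norm c < 1"
  shows "p \<in> fiber c \<longleftrightarrow> p \<in> solid_torus \<and> center p = c"
  using fiber_point[OF assms] mem_fiber_center by blast

section \<open>The planes and their normal frames\<close>

text \<open>By skewness of \<open>J i\<close>, the equations of the plane say that \<open>p\<close> is orthogonal to these vectors.\<close>

definition normal_vector :: "'a \<Rightarrow> nat \<Rightarrow> 'a" where
  "normal_vector c i = tilt c *\<^sub>R v i + J i c"

lemma plane_eq_orthogonal_comp: "plane c = (span (normal_vector c ` {1..n}))\<^sup>\<bottom>" (is "_ = ?R")
proof
  have iff: "orthogonal (normal_vector c i) p \<longleftrightarrow> tilt c * (p \<bullet> v i) = J i p \<bullet> c"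
    if "i \<in> {1..n}" for i p
    using J_skew[OF that, of p c]
    by (auto simp: orthogonal_def normal_vector_def inner_add_left
        inner_commute[of "v i" p] inner_commute[of "J i c" p])
  show "plane c \<subseteq> ?R"
  proof
    fix p assume "p \<in> plane c"
    then have "orthogonal p w" if "w \<in> normal_vector c ` {1..n}" for w
      using that iff by (auto simp: plane_def orthogonal_commute)
    then show "p \<in> ?R"
      using orthogonal_to_span orthogonal_commute unfolding orthogonal_comp_def by blast
  qed
  show "?R \<subseteq> plane c"
  proof
    fix p assume "p \<in> ?R"
    then have "orthogonal (normal_vector c i) p" if "i \<in> {1..n}" for i
      using that by (simp add: orthogonal_comp_def span_base)
    then show "p \<in> plane c"
      using iff by (simp add: plane_def)
  qed
qed

lemma subspace_plane: "subspace (plane c)"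
  unfolding plane_eq_orthogonal_comp by (rule subspace_orthogonal_comp)

text \<open>
  The coefficients of a linear relation are read off from inner products with the \<open>v j\<close>, because the
  matrix with entries \<open>normal_vector c i \<bullet> v j\<close> is \<open>tilt c\<close> times the identity.
\<close>

lemma normal_vector_independent:
  assumes "norm c < 1"
  shows "inj_on (normal_vector c) {1..n}" "independent (normal_vector c ` {1..n})"
proof -
  have inner: "normal_vector c i \<bullet> v j = (if i = j then tilt c else 0)"
    if "i \<in> {1..n}" "j \<in> {1..n}" for i j
    using that by (simp add: normal_vector_def inner_add_left v_orthonormal J_orthogonal_v)
  show inj: "inj_on (normal_vector c) {1..n}"
  proof (rule inj_onI)
    fix i j assume ij: "i \<in> {1..n}" "j \<in> {1..n}" "normal_vector c i = normal_vector c j"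
    then show "i = j"
      using inner[of i j] inner[of j j] tilt_pos[OF assms] by (auto split: if_splits)
  qed
  show "independent (normal_vector c ` {1..n})"
  proof (rule independent_if_scalars_zero)
    fix g w assume sum: "(\<Sum>w\<in>normal_vector c ` {1..n}. g w *\<^sub>R w) = 0"
      and "w \<in> normal_vector c ` {1..n}"
    then obtain j where j: "j \<in> {1..n}" "w = normal_vector c j" by blast
    have "0 = (\<Sum>i=1..n. g (normal_vector c i) *\<^sub>R normal_vector c i) \<bullet> v j"
      using sum by (simp add: sum.reindex[OF inj] del: One_nat_def)
    also have "\<dots> = (\<Sum>i=1..n. if i = j then g (normal_vector c i) * tilt c else 0)"
      unfolding inner_sum_left by (rule sum.cong) (use j inner in auto)
    also have "\<dots> = g w * tilt c"
      using j by simp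
    finally show "g w = 0"
      using tilt_pos[OF assms] by simp
  qed simp
qed

lemma dim_span_normal:
  assumes "norm c < 1"
  shows "dim (span (normal_vector c ` {1..n})) = n"
  using normal_vector_independent[OF assms]
  by (simp add: dim_eq_card_independent card_image)

lemma aff_dim_plane:
  assumes "norm c < 1"
  shows "aff_dim (plane c) = int n + 1"
proof -
  have "dim (plane c) + dim (span (normal_vector c ` {1..n})) = DIM('a)"
    using dim_subspace_orthogonal_to_vectors[of "span (normal_vector c ` {1..n})" UNIV]
    by (simp add: plane_eq_orthogonal_comp orthogonal_comp_def)
  then show ?thesis
    using dim_span_normal[OF assms] by (simp add: aff_dim_subspace[OF subspace_plane] DIM_eq)
qed

lemma normal_space_plane: "normal_space (plane c) = span (normal_vector c ` {1..n})"
proof -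
  have "normal_space (plane c) = (plane c)\<^sup>\<bottom>"
  proof (intro subset_antisym subsetI)
    fix w assume "w \<in> normal_space (plane c)"
    then show "w \<in> (plane c)\<^sup>\<bottom>"
      using subspace_0[OF subspace_plane, of c]
      by (fastforce simp: normal_space_def orthogonal_comp_def orthogonal_def inner_commute)
  next
    fix w assume "w \<in> (plane c)\<^sup>\<bottom>"
    then show "w \<in> normal_space (plane c)"
      by (simp add: normal_space_def orthogonal_comp_def orthogonal_def inner_diff_right
          inner_commute)
  qed
  then show ?thesis
    by (simp add: plane_eq_orthogonal_comp orthogonal_comp_self)
qed

lemma is_unit_sphere_in_fiber:
  assumes "c \<in> X" "norm c < 1"
  shows "is_unit_sphere_in n (plane c) c (fiber c)"
proof -
  have "c \<in> plane c"
    using assms(1) J_orthogonal[of 0 _ c] J_0_X[OF assms(1)]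
    by (simp add: plane_def X_def inner_commute)
  then show ?thesis
    using assms
    by (simp add: is_unit_sphere_in_def fiber_def subspace_imp_affine subspace_plane aff_dim_plane)
qed

section \<open>The fibration of the solid torus\<close>

lemma continuous_on_J: "i \<le> n \<Longrightarrow> continuous_on A (J i)"
  using J_linear linear_continuous_on linear_conv_bounded_linear by blast

lemma continuous_on_height: "continuous_on A height"
  unfolding height_def by (intro continuous_intros continuous_on_J) simp

lemma open_solid_torus: "open solid_torus"
  unfolding solid_torus_def
  by (intro open_Collect_less continuous_intros continuous_on_height)

lemma solid_torus_nonempty: "solid_torus \<noteq> {}"
proof -
  have "dim (v ` {1..n}) \<le> n"
    by (metis card_atLeastAtMost card_image_le diff_Suc_1 dim_le_card' finite_atLeastAtMost
        finite_imageI le_trans)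
  then have "span (v ` {1..n}) \<noteq> UNIV"
    using DIM_eq by (metis dim_UNIV dim_span le_add2 add_leD1 mult_2 not_less_eq_eq Suc_eq_plus1)
  then obtain p where p: "p \<notin> span (v ` {1..n})"
    by blast
  have "J 0 p \<noteq> 0"
  proof
    assume "J 0 p = 0"
    then have "p = (\<Sum>i=1..n. (p \<bullet> v i) *\<^sub>R v i)"
      by (simp add: J_0)
    also have "\<dots> \<in> span (v ` {1..n})"
      by (intro span_sum span_scale span_base) auto
    finally show False
      using p by simp
  qed
  moreover define q where "q = (1 / norm (J 0 p)) *\<^sub>R J 0 p"
  ultimately have "norm q = 1" "q \<in> X"
    using J_in_X[of 0 p] subspace_scale[OF subspace_X] by auto
  then have "q \<in> solid_torus"
    by (simp add: solid_torus_def height_def J_0_X)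
  then show ?thesis
    by blast
qed

lemma continuous_on_center: "continuous_on solid_torus center"
  unfolding center_def
  by (intro continuous_intros continuous_on_height continuous_on_J ballI)
    (auto dest: J_0_nonzero)

lemma continuous_on_normal_vector:
  assumes "i \<in> {1..n}"
  shows "continuous_on solid_torus (\<lambda>p. normal_vector (center p) i)"
  unfolding normal_vector_def tilt_def
  using assms
  by (intro continuous_intros continuous_on_center continuous_on_compose2[OF continuous_on_J[of i UNIV]])
    auto

lemma continuous_map_frame_span: "continuous_map (frame_space k) (grassmannian k) (frame_span k)"
  unfolding continuous_map_def
  using frame_span_in by (auto simp: topspace_grassmannian openin_grassmannian)

text \<open>
  A continuous choice of frames descends to a continuous map to the Grassmannian, which carries the
  quotient topology.
\<close>

lemma continuous_map_normal_space:
  "continuous_map (top_of_set solid_torus) (grassmannian n) (\<lambda>p. normal_space (plane (center p)))"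
proof -
  \<comment> \<open>Points of the product topology are extensional functions, hence the restriction.\<close>
  define f where "f p = (\<lambda>i\<in>{..<n}. normal_vector (center p) (Suc i))" for p
  have image: "f p ` {..<n} = normal_vector (center p) ` {1..n}" for p
  proof -
    have "f p ` {..<n} = normal_vector (center p) ` Suc ` {..<n}"
      by (simp add: f_def image_image)
    also have "Suc ` {..<n} = {1..n}"
      by (simp add: lessThan_atLeast0 atLeastLessThanSuc_atLeastAtMost)
    finally show ?thesis .
  qed
  have "continuous_map (top_of_set solid_torus) (frame_space n) f"
    unfolding frame_space_def continuous_map_in_subtopology continuous_map_componentwise
  proof (intro conjI ballI)
    show "f ` topspace (top_of_set solid_torus) \<subseteq> extensional {..<n}"
      by (auto simp: f_def)
    show "continuous_map (top_of_set solid_torus) euclidean (\<lambda>p. f p k)" if "k \<in> {..<n}" for k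
      using that continuous_on_normal_vector[of "Suc k"] by (simp add: f_def)
    show "f \<in> topspace (top_of_set solid_torus) \<rightarrow> {f. inj_on f {..<n} \<and> independent (f ` {..<n})}"
    proof (intro Pi_I CollectI conjI)
      fix p assume "p \<in> topspace (top_of_set solid_torus)"
      then have "norm (center p) < 1"
        by (simp add: norm_center_less_1)
      note indep = normal_vector_independent[OF this]
      show "independent (f p ` {..<n})"
        using indep(2) by (simp add: image)
      show "inj_on (f p) {..<n}"
        by (rule eq_card_imp_inj_on) (use indep(1) in \<open>simp_all add: image card_image\<close>)
    qed
  qed
  then have "continuous_map (top_of_set solid_torus) (grassmannian n) (frame_span n \<circ> f)"
    by (rule continuous_map_compose) (rule continuous_map_frame_span)
  moreover have "frame_span n \<circ> f = (\<lambda>p. normal_space (plane (center p)))"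
    by (auto simp: frame_span_def image normal_space_plane)
  ultimately show ?thesis
    by simp
qed

theorem unit_sphere_fibration_solid_torus:
  "unit_sphere_fibration n solid_torus (fiber ` {c \<in> X. norm c < 1})"
  unfolding unit_sphere_fibration_def
proof (intro conjI exI[of _ "\<lambda>p. plane (center p)"] exI[of _ center])
  show "\<forall>S\<in>fiber ` {c \<in> X. norm c < 1}. is_unit_sphere n S"
    using is_unit_sphere_in_fiber by (auto simp: is_unit_sphere_def)
  show "\<Union> (fiber ` {c \<in> X. norm c < 1}) = solid_torus"
    using mem_fiber_iff center_in_X norm_center_less_1 by auto
  show "pairwise disjnt (fiber ` {c \<in> X. norm c < 1})"
    by (auto simp: pairwise_def disjnt_iff mem_fiber_iff)
  show "\<forall>S\<in>fiber ` {c \<in> X. norm c < 1}. \<forall>p\<in>S. is_unit_sphere_in n (plane (center p)) (center p) S"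
    using mem_fiber_iff is_unit_sphere_in_fiber by auto
  show "continuous_on solid_torus center"
    by (rule continuous_on_center)
  show "continuous_map (top_of_set solid_torus) (grassmannian (DIM('a) - n - 1))
      (\<lambda>p. normal_space (plane (center p)))"
    using continuous_map_normal_space by (simp add: DIM_eq)
qed

end

section \<open>The octonion multiplication table\<close>

text \<open>
  With a suitable numbering of the octonion units, the product of the units \<open>i\<close> and \<open>j\<close> is, up to
  sign, the unit with the number \<open>i XOR j\<close>.  The entry \<open>(i, k)\<close> of the table is the sign in
  \<open>e\<^sub>i e\<^sub>j = \<plusminus> e\<^sub>k\<close>, where \<open>j = i XOR k\<close>.  The units below \<open>4\<close> span the quaternions, and
  those below \<open>2\<close> the complex numbers.
\<close>

definition octonion_sign :: "nat \<Rightarrow> nat \<Rightarrow> real" where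
  "octonion_sign i k =
    [[ 1,  1,  1,  1,  1,  1,  1,  1],
     [-1,  1, -1,  1, -1,  1,  1, -1],
     [-1,  1,  1, -1, -1, -1,  1,  1],
     [-1, -1,  1,  1, -1,  1, -1,  1],
     [-1,  1,  1,  1,  1, -1, -1, -1],
     [-1, -1,  1, -1,  1,  1,  1, -1],
     [-1, -1, -1,  1,  1, -1,  1,  1],
     [-1,  1, -1, -1,  1,  1, -1,  1]] ! i ! k"

text \<open>
  For \<open>i \<noteq> j\<close> the summands with the indices \<open>k\<close> and \<open>k XOR i XOR j\<close> contain the same product of
  values of \<open>a\<close>, and the signs make them cancel; for \<open>i = j\<close> the summands are squares, permuted by
  \<open>k \<mapsto> i XOR k\<close>.  The finitely many cases are checked one by one.
\<close>

lemma octonion_orthogonality: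
  assumes "n \<in> {1, 3, 7}" "i \<le> n" "j \<le> n"
  shows "(\<Sum>k\<le>n. (octonion_sign i k * a (xor i k)) * (octonion_sign j k * a (xor j k))) =
    (if i = j then \<Sum>k\<le>n. (a k)\<^sup>2 else 0)"
proof -
  have atMost_1: "{..1::nat} = {0, 1}" and atMost_3: "{..3::nat} = {0, 1, 2, 3}"
    and atMost_7: "{..7::nat} = {0, 1, 2, 3, 4, 5, 6, 7}"
    by auto
  consider "n = 1" | "n = 3" | "n = 7"
    using assms(1) by blast
  then show ?thesis
  proof cases
    case 1
    then have "i = 0 \<or> i = 1" "j = 0 \<or> j = 1"
      using assms by auto
    then show ?thesis
      unfolding 1 atMost_1
      by (elim disjE; simp add: octonion_sign_def power2_eq_square)
  next
    case 2
    then have "i = 0 \<or> i = 1 \<or> i = 2 \<or> i = 3" "j = 0 \<or> j = 1 \<or> j = 2 \<or> j = 3"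
      using assms by auto
    then show ?thesis
      unfolding 2 atMost_3
      by (elim disjE; simp add: octonion_sign_def power2_eq_square flip: numeral_2_eq_2)
  next
    case 3
    then have "i = 0 \<or> i = 1 \<or> i = 2 \<or> i = 3 \<or> i = 4 \<or> i = 5 \<or> i = 6 \<or> i = 7"
      "j = 0 \<or> j = 1 \<or> j = 2 \<or> j = 3 \<or> j = 4 \<or> j = 5 \<or> j = 6 \<or> j = 7"
      using assms by auto
    then show ?thesis
      unfolding 3 atMost_7
      by (elim disjE; simp add: octonion_sign_def power2_eq_square flip: numeral_2_eq_2)
  qed
qed
text \<open>
  The basis vectors \<open>b 0, \<dots>, b n\<close> play the role of the units of \<open>K\<close>, and \<open>b (n + 1), \<dots>, b (2 n)\<close>
  that of the imaginary units in the second summand.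
\<close>

lemma orthogonal_multiplication_octonion:
  fixes b :: "nat \<Rightarrow> 'a::euclidean_space"
  assumes n: "n \<in> {1, 3, 7}" and dim: "DIM('a) = 2 * n + 1"
    and b: "bij_betw b {..<2 * n + 1} Basis"
  shows "orthogonal_multiplication n (\<lambda>i. b (n + i))
    (\<lambda>i p. \<Sum>k\<le>n. (octonion_sign i k * (p \<bullet> b (xor i k))) *\<^sub>R b k)"
    (is "orthogonal_multiplication n ?v ?J")
proof (rule orthogonal_multiplication.intro)
  have inner: "b k \<bullet> b l = (if k = l then 1 else 0)" if "k \<le> 2 * n" "l \<le> 2 * n" for k l
  proof -
    have "b k \<in> Basis" "b l \<in> Basis" "b k = b l \<longleftrightarrow> k = l"
      using that b by (auto simp: bij_betw_def inj_on_eq_iff)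
    then show ?thesis
      by (simp add: inner_Basis)
  qed
  have inner_sum_b: "(\<Sum>k\<le>n. f k *\<^sub>R b k) \<bullet> b l = (if l \<le> n then f l else 0)"
    if "l \<le> 2 * n" for f l
  proof -
    have "(\<Sum>k\<le>n. f k *\<^sub>R b k) \<bullet> b l = (\<Sum>k\<le>n. if k = l then f k else 0)"
      unfolding inner_sum_left by (rule sum.cong) (use that inner in auto)
    then show ?thesis
      by simp
  qed
  have inner_sums: "(\<Sum>k\<le>n. f k *\<^sub>R b k) \<bullet> (\<Sum>k\<le>n. g k *\<^sub>R b k) = (\<Sum>k\<le>n. f k * g k)" for f g
    by (simp add: inner_sum_right inner_sum_b mult.commute)
  have J_0: "?J 0 p = (\<Sum>k\<le>n. (p \<bullet> b k) *\<^sub>R b k)" for p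
  proof (rule sum.cong)
    fix k assume "k \<in> {..n}"
    then have "k \<in> {0, 1, 2, 3, 4, 5, 6, 7}"
      using n by auto
    then have "octonion_sign 0 k = 1"
      by (auto simp: octonion_sign_def)
    then show "(octonion_sign 0 k * (p \<bullet> b (xor 0 k))) *\<^sub>R b k = (p \<bullet> b k) *\<^sub>R b k"
      by simp
  qed simp
  show "DIM('a) = 2 * n + 1"
    by (rule dim)
  show "?v i \<bullet> ?v j = (if i = j then 1 else 0)" if "i \<in> {1..n}" "j \<in> {1..n}" for i j
    using that inner by simp
  show "linear (?J i)" for i
    by (rule linearI)
      (simp_all add: inner_add_left algebra_simps sum.distrib scaleR_sum_right)
  show "?J i p \<bullet> ?v j = 0" if "j \<in> {1..n}" for i j p
    using that by (simp add: inner_sum_b)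
  show "?J i p \<bullet> ?J j p = (if i = j then (norm (?J 0 p))\<^sup>2 else 0)"
    if "i \<le> n" "j \<le> n" for i j p
    unfolding J_0 inner_sums power2_norm_eq_inner
    using octonion_orthogonality[OF n that, of "\<lambda>k. p \<bullet> b k"]
    by (simp add: power2_eq_square)
  show "?J 0 p = p - (\<Sum>i=1..n. (p \<bullet> ?v i) *\<^sub>R ?v i)" for p
  proof -
    have "p = (\<Sum>k<2 * n + 1. (p \<bullet> b k) *\<^sub>R b k)"
      using sum.reindex_bij_betw[OF b, of "\<lambda>u. (p \<bullet> u) *\<^sub>R u"] by (simp add: euclidean_representation)
    also have "{..<2 * n + 1} = {..n} \<union> (+) n ` {1..n}"
      by (auto simp: image_add_atLeastAtMost)
    also have "(\<Sum>k\<in>{..n} \<union> (+) n ` {1..n}. (p \<bullet> b k) *\<^sub>R b k) =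
        (\<Sum>k\<le>n. (p \<bullet> b k) *\<^sub>R b k) + (\<Sum>k\<in>(+) n ` {1..n}. (p \<bullet> b k) *\<^sub>R b k)"
      by (rule sum.union_disjoint) auto
    also have "(\<Sum>k\<in>(+) n ` {1..n}. (p \<bullet> b k) *\<^sub>R b k) = (\<Sum>i=1..n. (p \<bullet> ?v i) *\<^sub>R ?v i)"
      by (subst sum.reindex) (simp_all add: o_def)
    finally show ?thesis
      unfolding J_0 by (simp add: algebra_simps)
  qed
qed

theorem mainTheorem2:
  fixes n :: nat
  assumes "n \<in> {1, 3, 7}" and "CARD('d::finite) = 2 * n + 1"
  shows "\<exists>E :: (real ^ 'd) set. E \<noteq> {} \<and> open E \<and> (\<exists>F. unit_sphere_fibration n E F)"
proof -
  have dim: "DIM(real ^ 'd) = 2 * n + 1"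
    using assms(2) by simp
  then obtain b :: "nat \<Rightarrow> real ^ 'd" where "bij_betw b {..<2 * n + 1} Basis"
    using ex_bij_betw_nat_finite[OF finite_Basis] by (metis atLeast0LessThan)
  then interpret orthogonal_multiplication n "\<lambda>i. b (n + i)"
    "\<lambda>i p. \<Sum>k\<le>n. (octonion_sign i k * (p \<bullet> b (xor i k))) *\<^sub>R b k"
    by (rule orthogonal_multiplication_octonion[OF assms(1) dim])
  show ?thesis
    using solid_torus_nonempty open_solid_torus unit_sphere_fibration_solid_torus by blast
qed

end
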